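(* Let $n>3$ be an integer and let $G=C_{2n}(2,1,n)$ (a $5$-regular circulant graph). Then $G$ is word-representable and $R(G)\leq 3$. Furthermore, for $n=3$, the graph $C_6(2,1,3)$ is word-representable and $R(C_6(2,1,3))=1$.
   Context: Two distinct letters $x,y$ alternate in a word $w$ if, after deleting all other letters from $w$, the resulting word is of the form $xyxy\cdots$ or $yxyx\cdots$ (of even or odd length). A graph $G=(V,E)$ is word-representable if there is a word $w$ over the alphabet $V$, containing every letter of $V$ at least once, such that for all distinct $x,y\in V$, $xy\in E$ if and only if $x$ and $y$ alternate in $w$. A word is $k$-uniform if every letter occurs in it exactly $k$ times; $G$ is $k$-representable if some $k$-uniform word represents it, and the representation number $R(G)$ of a word-representable graph $G$ is the least such $k$. For an integer $m$ and a set $R$ of positive integers each at most $m/2$, the circulant graph $C_m(R)$ has vertex set $\{0,1,\dots,m-1\}$, with $i$ and $j$ adjacent iff $\min(|i-j|,\,m-|i-j|)\in R$. $C_{2n}(2,1,n)$ denotes the circulant graph on $2n$ vertices with jump set $\{1,2,n\}$. *)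

theory Defs
  imports Main
begin

text \<open>Graphs are given by a vertex set V and a symmetric adjacency relation E.\<close>

definition alternate :: "'a \<Rightarrow> 'a \<Rightarrow> 'a list \<Rightarrow> bool" where
  "alternate x y w \<longleftrightarrow>
     (let u = filter (\<lambda>c. c = x \<or> c = y) w in
        u = map (\<lambda>i. if even i then x else y) [0..<length u] \<or>
        u = map (\<lambda>i. if even i then y else x) [0..<length u])"

definition represents :: "'a set \<Rightarrow> ('a \<Rightarrow> 'a \<Rightarrow> bool) \<Rightarrow> 'a list \<Rightarrow> bool" where
  "represents V E w \<longleftrightarrow> set w = V \<and>
     (\<forall>x\<in>V. \<forall>y\<in>V. x \<noteq> y \<longrightarrow> (E x y \<longleftrightarrow> alternate x y w))"

definition word_representable :: "'a set \<Rightarrow> ('a \<Rightarrow> 'a \<Rightarrow> bool) \<Rightarrow> bool" where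
  "word_representable V E \<longleftrightarrow> (\<exists>w. represents V E w)"

definition uniform :: "nat \<Rightarrow> 'a list \<Rightarrow> bool" where
  "uniform k w \<longleftrightarrow> (\<forall>a\<in>set w. count_list w a = k)"

definition k_representable :: "nat \<Rightarrow> 'a set \<Rightarrow> ('a \<Rightarrow> 'a \<Rightarrow> bool) \<Rightarrow> bool" where
  "k_representable k V E \<longleftrightarrow> (\<exists>w. represents V E w \<and> uniform k w)"

definition representation_number :: "'a set \<Rightarrow> ('a \<Rightarrow> 'a \<Rightarrow> bool) \<Rightarrow> nat" where
  "representation_number V E = (LEAST k. k_representable k V E)"

definition circulant_adj :: "nat \<Rightarrow> nat set \<Rightarrow> nat \<Rightarrow> nat \<Rightarrow> bool" where
  "circulant_adj m R i j \<longleftrightarrow>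
     (let d = (if i \<le> j then j - i else i - j) in min d (m - d) \<in> R)"

end

theory Submission
  imports Defs
begin

text \<open>
  Place the letter \<open>i\<close> at the three points \<open>i\<close>, \<open>i + 2.8\<close> and \<open>i + n + 0.9\<close> of a circle of
  circumference \<open>2n\<close>. The gaps between these points are \<open>2.8\<close>, \<open>n - 1.9\<close> and \<open>n - 0.9\<close>, all
  greater than \<open>2\<close>. Rotating the triple by \<open>d \<le> 2\<close> therefore yields an interleaving triple, whereas
  for \<open>3 \<le> d \<le> n\<close> the rotated triple interleaves with the original one iff \<open>d\<close> lies in
  both \<open>(n - 1.9, n + 0.9)\<close> and \<open>(n - 0.9, n + 1.9)\<close>, i.e. iff \<open>d = n\<close>. Reading the circle off
  from \<open>0\<close> gives the 3-uniform word whose \<open>t\<close>-th block is \<open>t, t - 2, t + n\<close> modulo \<open>2n\<close>.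
\<close>

section \<open>Alternation as interleaving of positions\<close>

lemma alternate_commute: "alternate x y w \<longleftrightarrow> alternate y x w"
proof -
  have "filter (\<lambda>c. c = x \<or> c = y) w = filter (\<lambda>c. c = y \<or> c = x) w"
    by (rule filter_cong) auto
  then show ?thesis
    unfolding alternate_def Let_def by (simp only: disj_commute)
qed

lemma circulant_adj_commute: "circulant_adj m R i j \<longleftrightarrow> circulant_adj m R j i"
  unfolding circulant_adj_def by auto

lemma count_list_map_upt: "count_list (map f [0..<N]) a = card {k. k < N \<and> f k = a}"
proof -
  have "count_list (map f [0..<N]) a = length (filter (\<lambda>k. f k = a) [0..<N])"
    by (induction N) auto
  also have "\<dots> = card (set (filter (\<lambda>k. f k = a) [0..<N]))"
    by (intro distinct_card[symmetric]) simp
  also have "set (filter (\<lambda>k. f k = a) [0..<N]) = {k. k < N \<and> f k = a}"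
    by auto
  finally show ?thesis .
qed

text \<open>A strictly increasing list is determined by its set, so a filtered range of positions
  can be identified by guessing its entries in order.\<close>

lemma filter_upt_eq_sorted:
  assumes "{k. k < N \<and> P k} = set L" and "sorted_wrt (<) L"
  shows "filter P [0..<N] = L"
proof (rule sorted_distinct_set_unique)
  show "sorted (filter P [0..<N])" "distinct (filter P [0..<N])"
    by (simp_all add: sorted_wrt_filter)
  show "sorted L" "distinct L"
    using assms(2) by (simp_all add: strict_sorted_iff)
  show "set (filter P [0..<N]) = set L"
    using assms(1) by auto
qed

text \<open>Reduces alternation to integer inequalities: the six positions of \<open>x\<close> and
  \<open>y\<close>, taken in increasing order, must be occupied alternately by the two letters. The
  two chains correspond to \<open>x\<close> or \<open>y\<close> coming first.\<close>

lemma alternate_3_uniform_iff: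
  fixes f :: "nat \<Rightarrow> 'a"
  assumes "x \<noteq> y"
    and px: "{k. k < N \<and> f k = x} = {p1, p2, p3}" "p1 < p2" "p2 < p3"
    and qy: "{k. k < N \<and> f k = y} = {q1, q2, q3}" "q1 < q2" "q2 < q3"
  shows "alternate x y (map f [0..<N]) \<longleftrightarrow>
    p1 < q1 \<and> q1 < p2 \<and> p2 < q2 \<and> q2 < p3 \<and> p3 < q3 \<or>
    q1 < p1 \<and> p1 < q2 \<and> q2 < p2 \<and> p2 < q3 \<and> q3 < p3" (is "_ \<longleftrightarrow> ?I")
proof -
  define L where "L = filter (\<lambda>k. f k = x \<or> f k = y) [0..<N]"
  have u: "filter (\<lambda>c. c = x \<or> c = y) (map f [0..<N]) = map f L"
    by (simp add: L_def filter_map o_def)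
  have fp: "f p1 = x" "f p2 = x" "f p3 = x" and fq: "f q1 = y" "f q2 = y" "f q3 = y"
    using px(1) qy(1) by blast+
  have un: "{k. k < N \<and> (f k = x \<or> f k = y)} = {p1, p2, p3} \<union> {q1, q2, q3}"
    using px(1) qy(1) by blast
  have setL: "set L = {p1, p2, p3} \<union> {q1, q2, q3}"
    unfolding L_def un[symmetric] by auto
  have sortL: "sorted_wrt (<) L"
    unfolding L_def by (intro sorted_wrt_filter) simp
  \<comment> \<open>Disjointness gives exactly six positions, so \<open>L\<close> can be written out
    entry by entry.\<close>
  have "{p1, p2, p3} \<inter> {q1, q2, q3} = {}"
    using fp fq \<open>x \<noteq> y\<close> by auto
  then have "card (set L) = 6"
    using px(2,3) qy(2,3) unfolding setL by (subst card_Un_disjoint) auto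
  then have "length L = 6"
    using sortL by (metis distinct_card strict_sorted_iff)
  then obtain a b c d e g where L: "L = [a, b, c, d, e, g]"
    by (auto simp: eval_nat_numeral length_Suc_conv)
  have filter_x: "filter (\<lambda>k. f k = x) L = [p1, p2, p3]"
  proof -
    have "filter (\<lambda>k. f k = x) L = filter (\<lambda>k. f k = x) [0..<N]"
      by (auto simp: L_def intro: filter_cong)
    also have "\<dots> = [p1, p2, p3]"
      using px by (intro filter_upt_eq_sorted) auto
    finally show ?thesis .
  qed
  have filter_y: "filter (\<lambda>k. f k = y) L = [q1, q2, q3]"
  proof -
    have "filter (\<lambda>k. f k = y) L = filter (\<lambda>k. f k = y) [0..<N]"
      by (auto simp: L_def intro: filter_cong)
    also have "\<dots> = [q1, q2, q3]"
      using qy by (intro filter_upt_eq_sorted) auto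
    finally show ?thesis .
  qed
  have alt: "alternate x y (map f [0..<N]) \<longleftrightarrow>
      map f L = [x, y, x, y, x, y] \<or> map f L = [y, x, y, x, y, x]"
    unfolding alternate_def u Let_def by (simp add: L upt_rec)
  show ?thesis
  proof
    \<comment> \<open>The letter pattern says which entries of \<open>L\<close> survive in
      \<open>filter_x\<close> and \<open>filter_y\<close>; this names all six, and the sortedness of
      \<open>L\<close> gives the chain.\<close>
    assume "alternate x y (map f [0..<N])"
    then show ?I
      using filter_x filter_y sortL \<open>x \<noteq> y\<close> unfolding alt L by auto
  next
    assume ?I
    then show "alternate x y (map f [0..<N])"
    proof
      assume *: "p1 < q1 \<and> q1 < p2 \<and> p2 < q2 \<and> q2 < p3 \<and> p3 < q3"
      then have "L = [p1, q1, p2, q2, p3, q3]"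
        unfolding L_def by (intro filter_upt_eq_sorted) (auto simp: un)
      then show ?thesis unfolding alt by (simp add: fp fq)
    next
      assume *: "q1 < p1 \<and> p1 < q2 \<and> q2 < p2 \<and> p2 < q3 \<and> q3 < p3"
      then have "L = [q1, p1, q2, p2, q3, p3]"
        unfolding L_def by (intro filter_upt_eq_sorted) (auto simp: un)
      then show ?thesis unfolding alt by (simp add: fp fq)
    qed
  qed
qed

section \<open>The 3-uniform word and its occurrences\<close>

text \<open>Blocks have length three, so \<open>k div 3\<close> is the block and
  \<open>k mod 3\<close> the slot in it. The conditionals reduce modulo \<open>2 * n\<close> while
  keeping subtraction on naturals from truncating.\<close>

definition block_letter :: "nat \<Rightarrow> nat \<Rightarrow> nat" where
  "block_letter n k =
     (let t = k div 3 in
      if k mod 3 = 0 then t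
      else if k mod 3 = 1 then (if t < 2 then t + 2 * n - 2 else t - 2)
      else (if t < n then t + n else t - n))"

definition block_word :: "nat \<Rightarrow> nat list" where
  "block_word n = map (block_letter n) [0..<6 * n]"

text \<open>The three occurrences of a letter in increasing order; the two later cases are those in which
  one, respectively two, of its points pass the origin of the circle.\<close>

definition occ1 :: "nat \<Rightarrow> nat \<Rightarrow> nat" where
  "occ1 n x = (if x < n then 3 * x else if x + 2 < 2 * n then 3 * (x - n) + 2
     else 3 * (x + 2 - 2 * n) + 1)"

definition occ2 :: "nat \<Rightarrow> nat \<Rightarrow> nat" where
  "occ2 n x = (if x < n then 3 * x + 7 else if x + 2 < 2 * n then 3 * x
     else 3 * (x - n) + 2)"

definition occ3 :: "nat \<Rightarrow> nat \<Rightarrow> nat" where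
  "occ3 n x = (if x < n then 3 * (x + n) + 2 else if x + 2 < 2 * n then 3 * x + 7
     else 3 * x)"

lemma occ_less:
  assumes "n > 3" "x < 2 * n"
  shows "occ1 n x < occ2 n x" "occ2 n x < occ3 n x"
  using assms unfolding occ1_def occ2_def occ3_def by auto

lemma block_letter_eq_iff:
  assumes "n > 3" "x < 2 * n" "k < 6 * n"
  shows "block_letter n k = x \<longleftrightarrow> k = occ1 n x \<or> k = occ2 n x \<or> k = occ3 n x"
proof -
  \<comment> \<open>The letter \<open>x\<close> sits in the first slot of block \<open>x\<close>,
    the second of block \<open>x + 2\<close> and the third of block \<open>x + n\<close>, modulo
    \<open>2 * n\<close>; \<open>occ1\<close>, \<open>occ2\<close>, \<open>occ3\<close> merely sort
    these positions.\<close>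
  define r where "r = (if x + 2 < 2 * n then x + 2 else x + 2 - 2 * n)"
  define s where "s = (if x < n then x + n else x - n)"
  have occ: "k = occ1 n x \<or> k = occ2 n x \<or> k = occ3 n x \<longleftrightarrow>
      k = 3 * x \<or> k = 3 * r + 1 \<or> k = 3 * s + 2"
    using assms unfolding occ1_def occ2_def occ3_def r_def s_def by auto
  define t where "t = k div 3"
  have t: "t < 2 * n" using assms(3) unfolding t_def by linarith
  have div_mod: "k = 3 * m + c \<longleftrightarrow> t = m \<and> k mod 3 = c" if "c < 3" for m c
    using that unfolding t_def by (auto simp: mult.commute)
  \<comment> \<open>These two equivalences invert the rotations by 2 and by \<open>n\<close>; the
    latter is its own inverse.\<close>
  have r: "t = r \<longleftrightarrow> (if t < 2 then t + 2 * n - 2 else t - 2) = x"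
    using t assms unfolding r_def by auto
  have s: "t = s \<longleftrightarrow> (if t < n then t + n else t - n) = x"
    using t assms unfolding s_def by auto
  have occ': "k = 3 * x \<or> k = 3 * r + 1 \<or> k = 3 * s + 2 \<longleftrightarrow>
      t = x \<and> k mod 3 = 0 \<or> t = r \<and> k mod 3 = 1 \<or> t = s \<and> k mod 3 = 2"
    using div_mod[of 0 x] div_mod[of 1 r] div_mod[of 2 s] by simp
  consider "k mod 3 = 0" | "k mod 3 = 1" | "k mod 3 = 2" by linarith
  then show ?thesis
    unfolding occ occ' r s block_letter_def Let_def t_def[symmetric] by cases simp_all
qed

lemma block_letter_occurrences:
  assumes "n > 3" "x < 2 * n"
  shows "{k. k < 6 * n \<and> block_letter n k = x} = {occ1 n x, occ2 n x, occ3 n x}"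
proof -
  \<comment> \<open>Bounding the largest occurrence suffices, as the other two are smaller.\<close>
  have "occ3 n x < 6 * n"
    using assms unfolding occ3_def by auto
  then show ?thesis
    using occ_less[OF assms] block_letter_eq_iff[OF assms] by fastforce
qed

lemma set_block_word:
  assumes "n > 3"
  shows "set (block_word n) = {0..<2 * n}"
proof
  show "set (block_word n) \<subseteq> {0..<2 * n}"
    using assms by (auto simp: block_word_def block_letter_def Let_def)
  show "{0..<2 * n} \<subseteq> set (block_word n)"
  proof
    fix x assume "x \<in> {0..<2 * n}"
    then have "occ1 n x \<in> {k. k < 6 * n \<and> block_letter n k = x}"
      using block_letter_occurrences[OF assms, of x] by auto
    then show "x \<in> set (block_word n)"
      by (force simp: block_word_def)
  qed
qed

lemma uniform_block_word:
  assumes "n > 3"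
  shows "uniform 3 (block_word n)"
  unfolding uniform_def
proof
  fix x assume "x \<in> set (block_word n)"
  then have "x < 2 * n" using set_block_word[OF assms] by simp
  then show "count_list (block_word n) x = 3"
    using occ_less[OF assms, of x] unfolding block_word_def count_list_map_upt
    by (simp add: block_letter_occurrences[OF assms])
qed

section \<open>Adjacency matches alternation\<close>

lemma circulant_adj_iff_alternate_block_word_less:
  assumes "n > 3" "x < y" "y < 2 * n"
  shows "circulant_adj (2 * n) {1, 2, n} x y \<longleftrightarrow> alternate x y (block_word n)"
proof -
  have x: "x < 2 * n" using assms by simp
  \<comment> \<open>Jumps 1 and 2 can also wrap around the circle, whereas \<open>n\<close> is its
    own complement in \<open>2 * n\<close> and gives one equation only.\<close>
  have adj: "circulant_adj (2 * n) {1, 2, n} x y \<longleftrightarrow>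
      y = x + 1 \<or> y = x + 2 \<or> y = x + n \<or> y + 1 = x + 2 * n \<or> y + 2 = x + 2 * n"
    using assms unfolding circulant_adj_def Let_def min_def by auto
  have alt: "alternate x y (block_word n) \<longleftrightarrow>
      occ1 n x < occ1 n y \<and> occ1 n y < occ2 n x \<and> occ2 n x < occ2 n y \<and>
        occ2 n y < occ3 n x \<and> occ3 n x < occ3 n y \<or>
      occ1 n y < occ1 n x \<and> occ1 n x < occ2 n y \<and> occ2 n y < occ2 n x \<and>
        occ2 n x < occ3 n y \<and> occ3 n y < occ3 n x"
    unfolding block_word_def
    using block_letter_occurrences[OF assms(1) x] occ_less[OF assms(1) x]
      block_letter_occurrences[OF assms(1,3)] occ_less[OF assms(1,3)] assms(2)
    by (intro alternate_3_uniform_iff) auto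
  \<comment> \<open>The formulas for the occurrences change at \<open>n\<close> and at
    \<open>2 * n - 2\<close>. The six cases are the pairs of ranges possible for
    \<open>x < y\<close>; in each, only linear arithmetic remains.\<close>
  consider "y < n" | "x < n" "n \<le> y" "y + 2 < 2 * n" | "x < n" "2 * n \<le> y + 2"
    | "n \<le> x" "y + 2 < 2 * n" | "n \<le> x" "x + 2 < 2 * n" "2 * n \<le> y + 2"
    | "2 * n \<le> x + 2"
    by linarith
  then show ?thesis
  proof cases
    case 1
    then show ?thesis unfolding adj alt occ1_def occ2_def occ3_def using assms by auto
  next
    case 2
    then show ?thesis unfolding adj alt occ1_def occ2_def occ3_def using assms by auto
  next
    case 3
    then show ?thesis unfolding adj alt occ1_def occ2_def occ3_def using assms by auto
  next
    case 4
    then show ?thesis unfolding adj alt occ1_def occ2_def occ3_def using assms by auto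
  next
    case 5
    then show ?thesis unfolding adj alt occ1_def occ2_def occ3_def using assms by auto
  next
    case 6
    then show ?thesis unfolding adj alt occ1_def occ2_def occ3_def using assms by auto
  qed
qed

lemma represents_block_word:
  assumes "n > 3"
  shows "represents {0..<2 * n} (circulant_adj (2 * n) {1, 2, n}) (block_word n)"
  unfolding represents_def set_block_word[OF assms]
proof (intro conjI ballI impI refl)
  fix x y assume "x \<in> {0..<2 * n}" "y \<in> {0..<2 * n}" "x \<noteq> y"
  then consider "x < y" "y < 2 * n" | "y < x" "x < 2 * n"
    by (metis atLeastLessThan_iff nat_neq_iff)
  then show "circulant_adj (2 * n) {1, 2, n} x y \<longleftrightarrow> alternate x y (block_word n)"
  proof cases
    case 1
    then show ?thesis by (rule circulant_adj_iff_alternate_block_word_less[OF assms])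
  next
    case 2
    then show ?thesis
      using circulant_adj_iff_alternate_block_word_less[OF assms]
      by (simp add: circulant_adj_commute[of _ _ x] alternate_commute[of x])
  qed
qed

section \<open>The complete graph on six vertices\<close>

lemma alternate_distinct:
  assumes "distinct w" "x \<in> set w" "y \<in> set w" "x \<noteq> y"
  shows "alternate x y w"
proof -
  define u where "u = filter (\<lambda>c. c = x \<or> c = y) w"
  have "set u = {x, y}" "distinct u" using assms by (auto simp: u_def)
  moreover from this have "length u = 2" using assms(4) by (metis card_2_iff distinct_card)
  moreover from this obtain a b where "u = [a, b]"
    by (auto simp: eval_nat_numeral length_Suc_conv)
  ultimately have "u = [x, y] \<or> u = [y, x]"
    by (auto simp: doubleton_eq_iff)
  then show ?thesis unfolding alternate_def u_def[symmetric] Let_def by auto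
qed

text \<open>Distances on a 6-cycle never exceed 3, so the graph is complete, and any two letters of
  a permutation alternate.\<close>

lemma represents_complete_6: "represents {0..<6} (circulant_adj 6 {1, 2, 3}) [0..<6]"
proof -
  have "circulant_adj 6 {1, 2, 3} x y" if "x < 6" "y < 6" "x \<noteq> y" for x y
    using that unfolding circulant_adj_def Let_def min_def by auto
  then show ?thesis
    unfolding represents_def by (auto intro: alternate_distinct)
qed

text \<open>Every vertex must occur in the word; this is the lower bound in the case
  \<open>n = 3\<close>.\<close>

lemma not_0_representable:
  assumes "V \<noteq> {}"
  shows "\<not> k_representable 0 V E"
  using assms unfolding k_representable_def represents_def uniform_def
  by (auto simp: count_list_0_iff)

theorem theorem29:
  shows "(\<forall>n::nat. n > 3 \<longrightarrow>
            word_representable {0..<2*n} (circulant_adj (2*n) {1, 2, n}) \<and>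
            representation_number {0..<2*n} (circulant_adj (2*n) {1, 2, n}) \<le> 3) \<and>
         (word_representable {0..<6::nat} (circulant_adj 6 {1, 2, 3}) \<and>
            representation_number {0..<6::nat} (circulant_adj 6 {1, 2, 3}) = 1)"
proof (intro conjI allI impI)
  fix n :: nat assume n: "n > 3"
  show "word_representable {0..<2*n} (circulant_adj (2*n) {1, 2, n})"
    unfolding word_representable_def using represents_block_word[OF n] by blast
  show "representation_number {0..<2*n} (circulant_adj (2*n) {1, 2, n}) \<le> 3"
    unfolding representation_number_def k_representable_def
    using represents_block_word[OF n] uniform_block_word[OF n] by (blast intro: Least_le)
next
  show "word_representable {0..<6::nat} (circulant_adj 6 {1, 2, 3})"
    unfolding word_representable_def using represents_complete_6 by blast
  show "representation_number {0..<6::nat} (circulant_adj 6 {1, 2, 3}) = 1"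
    unfolding representation_number_def
  proof (rule Least_equality)
    have "uniform 1 [0..<6]"
      by (simp add: uniform_def count_list_map_upt[where f = "\<lambda>k. k", simplified] card_1_singleton_iff)
        auto
    then show "k_representable 1 {0..<6} (circulant_adj 6 {1, 2, 3})"
      unfolding k_representable_def using represents_complete_6 by blast
    show "1 \<le> k" if "k_representable k {0..<6} (circulant_adj 6 {1, 2, 3})" for k
      using that not_0_representable[of "{0..<6::nat}"] by (cases k) auto
  qed
qed

end
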